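(* Let $X$ and $Y$ be independent and identically distributed real random variables with probability density function $f$ that is positive over a bounded or infinite open interval $I\subseteq\mathbb{R}$ and equal to $0$ outside $I$. Then the conditional density of $U:=X+Y$ given $X-Y=v$ is of the form $A\,f(Au+B|v|)$ (as a function of $u$) for some real numbers $A>0$ and $B$ if and only if the distribution of $X$ is either exponential, or negative exponential (that is, the distribution of $-X$ is exponential), or normal.
   Context: The numbers $A$ and $B$ are constants, not depending on $u$ or $v$. The joint density of $U=X+Y$ and $V=X-Y$ is $\frac12 f\left(\frac{u+v}{2}\right)f\left(\frac{u-v}{2}\right)$, and the density of $V$ is $g(v)=\frac12\int_{-\infty}^{\infty}f\left(\frac{u+v}{2}\right)f\left(\frac{u-v}{2}\right)\,du$, which is positive if and only if $|v|<|I|$, where $|I|$ is the length of $I$. The conditional density of $U$ given $X-Y=v$ is the joint density divided by $g(v)$, for $|v|<|I|$.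
   Formalization: "Normal" is taken to mean normal with mean 0: for a normal X with nonzero mean the conditional density of U given X-Y=v is not of the form A f(Au+B|v|), so the "if" part fails there. *)

theory Defs
  imports "HOL-Probability.Probability"
begin

text \<open>For independent \<open>X\<close>, \<open>Y\<close> with common density \<open>f\<close>: the joint density of
  \<open>U = X + Y\<close> and \<open>V = X - Y\<close>, the density of \<open>V\<close>, and the conditional density
  of \<open>U\<close> given \<open>V = v\<close>. The factor 1/2 is the Jacobian of \<open>(u, v) \<mapsto> ((u + v)/2, (u - v)/2)\<close>.\<close>

definition sum_diff_density :: "(real \<Rightarrow> real) \<Rightarrow> real \<Rightarrow> real \<Rightarrow> real" where
  "sum_diff_density f u v = 1 / 2 * f ((u + v) / 2) * f ((u - v) / 2)"

text \<open>If the integral diverges at some \<open>v\<close>, the value below is 0 by convention, and then so is the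
  conditional density; it is then not a probability density in \<open>u\<close>.\<close>

definition diff_density :: "(real \<Rightarrow> real) \<Rightarrow> real \<Rightarrow> real" where
  "diff_density f v = (LINT u|lborel. sum_diff_density f u v)"

definition sum_cond_density :: "(real \<Rightarrow> real) \<Rightarrow> real \<Rightarrow> real \<Rightarrow> real" where
  "sum_cond_density f v u = sum_diff_density f u v / diff_density f v"

lemma distributed_sum_diff:
  fixes X Y :: "'a \<Rightarrow> real" and f :: "real \<Rightarrow> real"
  assumes M: "prob_space M"
    and ind: "prob_space.indep_var M borel X borel Y"
    and X: "distributed M lborel X f" and Y: "distributed M lborel Y f"
    and nonneg: "\<And>x. 0 \<le> f x"
  shows "distributed M (lborel \<Otimes>\<^sub>M lborel) (\<lambda>\<omega>. (X \<omega> + Y \<omega>, X \<omega> - Y \<omega>))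
           (\<lambda>(u, v). sum_diff_density f u v)"
proof -
  interpret prob_space M by fact
  have fm[measurable]: "f \<in> borel_measurable borel"
    using distributed_real_measurable[OF _ X] nonneg by simp
  have Xm[measurable]: "X \<in> borel_measurable M" and Ym[measurable]: "Y \<in> borel_measurable M"
    using distributed_measurable[OF X] distributed_measurable[OF Y] by simp_all
  have ind': "indep_var lborel X lborel Y"
  proof -
    have s: "sets (case_bool lborel lborel i) = sets (case_bool borel borel i :: real measure)" for i
      by (cases i; simp)
    have "indep_sets (\<lambda>i. {case_bool X Y i -` A \<inter> space M |A. A \<in> sets (case_bool borel borel i)}) UNIV"
      using ind unfolding indep_var_def indep_vars_def2 by blast
    moreover have "random_variable (case_bool lborel lborel i) (case_bool X Y i)" for i
      by (cases i; simp)
    ultimately show ?thesis unfolding indep_var_def indep_vars_def2 s by blast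
  qed
  have J: "distributed M (lborel \<Otimes>\<^sub>M lborel) (\<lambda>\<omega>. (X \<omega>, Y \<omega>)) (\<lambda>(x, y). ennreal (f x) * ennreal (f y))"
    by (rule distributed_joint_indep[OF _ _ X Y ind']) (rule lborel.sigma_finite_measure_axioms)+
  have sm: "(\<lambda>(u, v). ennreal (sum_diff_density f u v)) \<in> borel_measurable (lborel \<Otimes>\<^sub>M lborel)"
    unfolding sum_diff_density_def by measurable
  have sd: "ennreal (sum_diff_density f u v)
      = ennreal (1 / 2) * (ennreal (f ((u + v) / 2)) * ennreal (f ((u - v) / 2)))" for u v
    unfolding sum_diff_density_def mult.assoc
    by (subst ennreal_mult; (subst ennreal_mult)?; simp add: nonneg)
  show ?thesis
    unfolding distributed_def
  proof (intro conjI)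
    show "(\<lambda>\<omega>. (X \<omega> + Y \<omega>, X \<omega> - Y \<omega>)) \<in> measurable M (lborel \<Otimes>\<^sub>M lborel)" by measurable
    show "(\<lambda>x. ennreal (case x of (u, v) \<Rightarrow> sum_diff_density f u v)) \<in> borel_measurable (lborel \<Otimes>\<^sub>M lborel)"
      using sm by (simp add: case_prod_beta)
    show "distr M (lborel \<Otimes>\<^sub>M lborel) (\<lambda>\<omega>. (X \<omega> + Y \<omega>, X \<omega> - Y \<omega>)) =
      density (lborel \<Otimes>\<^sub>M lborel) (\<lambda>x. ennreal (case x of (u, v) \<Rightarrow> sum_diff_density f u v))"
    proof (rule measure_eqI)
      fix C assume "C \<in> sets (distr M (lborel \<Otimes>\<^sub>M lborel) (\<lambda>\<omega>. (X \<omega> + Y \<omega>, X \<omega> - Y \<omega>)))"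
      then have C0: "C \<in> sets (lborel \<Otimes>\<^sub>M lborel)" by simp
      then have C[measurable]: "C \<in> sets (borel \<Otimes>\<^sub>M borel)"
        by (simp cong: sets_pair_measure_cong)
      have "emeasure (distr M (lborel \<Otimes>\<^sub>M lborel) (\<lambda>\<omega>. (X \<omega> + Y \<omega>, X \<omega> - Y \<omega>))) C
          = (\<integral>\<^sup>+ \<omega>. indicator C (X \<omega> + Y \<omega>, X \<omega> - Y \<omega>) \<partial>M)"
        using C0 by (subst nn_integral_indicator[symmetric], simp, subst nn_integral_distr) auto
      also have "\<dots> = (\<integral>\<^sup>+ p. ennreal (f (fst p)) * ennreal (f (snd p)) *
          indicator C (fst p + snd p, fst p - snd p) \<partial>(lborel \<Otimes>\<^sub>M lborel))"
        using distributed_nn_integral[OF J, of "\<lambda>p. indicator C (fst p + snd p, fst p - snd p)"]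
        by (simp add: case_prod_beta)
      also have "\<dots> = (\<integral>\<^sup>+ y. \<integral>\<^sup>+ x. ennreal (f x) * ennreal (f y) * indicator C (x + y, x - y) \<partial>lborel \<partial>lborel)"
        by (subst lborel_pair.nn_integral_snd[symmetric]) (auto simp: case_prod_beta)
      also have "\<dots> = (\<integral>\<^sup>+ y. \<integral>\<^sup>+ v. ennreal (f (y + v)) * ennreal (f y) * indicator C (2 * y + v, v) \<partial>lborel \<partial>lborel)"
      proof (rule nn_integral_cong)
        fix y :: real
        show "(\<integral>\<^sup>+ x. ennreal (f x) * ennreal (f y) * indicator C (x + y, x - y) \<partial>lborel)
          = (\<integral>\<^sup>+ v. ennreal (f (y + v)) * ennreal (f y) * indicator C (2 * y + v, v) \<partial>lborel)"
          by (subst nn_integral_real_affine[where c = 1 and t = y]) (auto simp: algebra_simps)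
      qed
      also have "\<dots> = (\<integral>\<^sup>+ v. \<integral>\<^sup>+ y. ennreal (f (y + v)) * ennreal (f y) * indicator C (2 * y + v, v) \<partial>lborel \<partial>lborel)"
        by (rule lborel_pair.Fubini') measurable
      also have "\<dots> = (\<integral>\<^sup>+ v. \<integral>\<^sup>+ u. ennreal (sum_diff_density f u v) * indicator C (u, v) \<partial>lborel \<partial>lborel)"
      proof (rule nn_integral_cong)
        fix v :: real
        have "(\<integral>\<^sup>+ y. ennreal (f (y + v)) * ennreal (f y) * indicator C (2 * y + v, v) \<partial>lborel)
          = ennreal (1/2) * (\<integral>\<^sup>+ u. ennreal (f ((u + v) / 2)) * ennreal (f ((u - v) / 2)) * indicator C (u, v) \<partial>lborel)"
          by (subst nn_integral_real_affine[where c = "1/2" and t = "- v / 2"])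
             (auto simp: field_simps intro!: arg_cong2[where f = "(*)"] nn_integral_cong)
        also have "\<dots> = (\<integral>\<^sup>+ u. ennreal (sum_diff_density f u v) * indicator C (u, v) \<partial>lborel)"
          unfolding sd by (subst nn_integral_cmult[symmetric]) (auto simp only: mult.assoc, measurable)
        finally show "(\<integral>\<^sup>+ y. ennreal (f (y + v)) * ennreal (f y) * indicator C (2 * y + v, v) \<partial>lborel)
          = (\<integral>\<^sup>+ u. ennreal (sum_diff_density f u v) * indicator C (u, v) \<partial>lborel)" .
      qed
      also have "\<dots> = (\<integral>\<^sup>+ p. ennreal (case p of (u, v) \<Rightarrow> sum_diff_density f u v) * indicator C p \<partial>(lborel \<Otimes>\<^sub>M lborel))"
        using sm C0 by (subst lborel_pair.nn_integral_snd[symmetric]) (auto simp: case_prod_beta)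
      also have "\<dots> = emeasure (density (lborel \<Otimes>\<^sub>M lborel) (\<lambda>x. ennreal (case x of (u, v) \<Rightarrow> sum_diff_density f u v))) C"
        using sm C0 by (subst emeasure_density) (auto simp: case_prod_beta)
      finally show "emeasure (distr M (lborel \<Otimes>\<^sub>M lborel) (\<lambda>\<omega>. (X \<omega> + Y \<omega>, X \<omega> - Y \<omega>))) C =
        emeasure (density (lborel \<Otimes>\<^sub>M lborel) (\<lambda>x. ennreal (case x of (u, v) \<Rightarrow> sum_diff_density f u v))) C" .
    qed simp
  qed
qed

end

(* Wherever g > 0, the hypothesis reads
     f((u+v)/2) f((u-v)/2) = k(v) f(A u + B |v|)   for almost every u, with k(v) > 0.
   Comparing supports for two values of v shows that I is not bounded, and that B = -A on a half-line
   (a, oo). There, dividing by the equation for v = 0 gives f(x+v) = c(v) f(x) for x > a, so the tail of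
   X - a is multiplicative and X - a is exponential; moreover a = 0, since otherwise A = 1/2 and f would
   be constant. The half-line (-oo, b) follows by reflection. On the whole line put d = B/A; then
     f(x+w) f(x-w) = G(w) f(x + d w)^2   for w >= 0,
   and combining these equations for w = 1 and w = 2 gives f(x+2d) = c f(x), which is impossible for an
   integrable f unless d = 0. So B = 0, and A (X+Y) is distributed like X and independent of X - Y. For
   the characteristic function phi of X this says phi(As+t) phi(As-t) = phi(s) phi(t) phi(-t), a
   quadratic equation for ln |phi|; the phase of phi is trivial because it is invariant under
   s -> sqrt 2 * s and continuous at 0. *)

theory Submission
  imports Defs
begin

section \<open>Null sets of the line\<close>

text \<open>The exceptional points lie in a measurable null set \<open>N\<close>, whose preimage
  under an affine bijection is null; going through \<open>N\<close> covers predicates of unknown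
  measurability.\<close>

lemma AE_lborel_affine:
  fixes c t :: real
  assumes "AE x in lborel. P x" and c: "c \<noteq> 0"
  shows "AE x in lborel. P (t + c * x)"
proof -
  obtain N where N: "{x \<in> space lborel. \<not> P x} \<subseteq> N" "emeasure lborel N = 0" "N \<in> sets lborel"
    using assms(1) by (auto elim: AE_E)
  then have "AE x in lborel. x \<notin> N"
    by (intro AE_not_in) auto
  moreover have "Measurable.pred borel (\<lambda>x. x \<notin> N)"
    using N(3) by (simp add: pred_def)
  ultimately have "AE x in lborel. t + c * x \<notin> N"
    using AE_borel_affine[OF c] by blast
  then show ?thesis
    by (rule eventually_mono) (use N(1) in auto)
qed

text \<open>A null open interval is empty. This turns almost-everywhere statements into exact ones
  about endpoints.\<close>

lemma not_AE_lborel_Ioo: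
  fixes p q :: real
  assumes "AE x in lborel. P x" "\<And>x. p < x \<Longrightarrow> x < q \<Longrightarrow> \<not> P x"
  shows "q \<le> p"
proof (rule ccontr)
  assume "\<not> q \<le> p"
  have "AE x in lborel. x \<notin> {p<..<q}"
    using assms by (auto elim: eventually_mono)
  then have "emeasure lborel {p<..<q} = 0"
    by (subst (asm) AE_iff_measurable[of "{p<..<q}"]) auto
  then show False
    using \<open>\<not> q \<le> p\<close> by simp
qed

lemma AE_eq_Ioi_imp:
  fixes p r :: real
  assumes "AE u in lborel. p < u \<longleftrightarrow> r < u"
  shows "p = r"
  using not_AE_lborel_Ioo[OF assms, of p r] not_AE_lborel_Ioo[OF assms, of r p] by force

lemma AE_eq_Ioo_imp:
  fixes p q r s :: real
  assumes AE: "AE u in lborel. p < u \<and> u < q \<longleftrightarrow> r < u \<and> u < s" and "p < q"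
  shows "p = r" "q = s"
proof -
  \<comment> \<open>Each inequality says that one piece of the symmetric difference is empty; the
    first concerns the points of \<open>(p, q)\<close> to the left of \<open>r\<close>.\<close>
  have 1: "min q r \<le> p" "max p s \<ge> q"
    by (rule not_AE_lborel_Ioo[OF AE]; force)+
  have 2: "min p s \<le> r" "max q r \<ge> s"
    by (rule not_AE_lborel_Ioo[OF AE]; force)+
  show "p = r" "q = s"
    using 1 2 \<open>p < q\<close> by (auto simp: min_def max_def split: if_splits)
qed

text \<open>Half-lines have infinite length, so on them the functional equation is available for
  every real \<open>v\<close>.\<close>

lemma ennreal_less_emeasure_half_line:
  fixes a r :: real
  assumes "0 \<le> r"
  shows "ennreal r < emeasure lborel {a<..}" "ennreal r < emeasure lborel {..<a}"
proof -
  have "ennreal r < emeasure lborel {a<..<a + r + 1}"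
    using assms by (simp add: ennreal_less_iff)
  also have "\<dots> \<le> emeasure lborel {a<..}"
    by (rule emeasure_mono) auto
  finally show "ennreal r < emeasure lborel {a<..}" .
  have "ennreal r < emeasure lborel {a - r - 1<..<a}"
    using assms by (simp add: ennreal_less_iff)
  also have "\<dots> \<le> emeasure lborel {..<a}"
    by (rule emeasure_mono) auto
  finally show "ennreal r < emeasure lborel {..<a}" .
qed

text \<open>An open set equals its interior, and the interior of any interval is empty or of one of
  these four shapes.\<close>

lemma open_interval_cases:
  fixes I :: "real set"
  assumes "open I" "is_interval I" "I \<noteq> {}"
  obtains "I = UNIV" | a where "I = {a<..}" | b where "I = {..<b}"
    | a b where "a < b" "I = {a<..<b}"
proof -
  have I: "interior I = I"
    using assms(1) by (rule interior_open)
  obtain a b where "I = UNIV \<or> I = {..<b} \<or> I = {..b} \<or> I = {a<..} \<or> I = {a..} \<or>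
      I = {a<..<b} \<or> I = {a<..b} \<or> I = {a..<b} \<or> I = {a..b}"
    using is_real_interval[OF assms(2)] assms(3) by blast
  then have "I = UNIV \<or> I = {..<b} \<or> I = {a<..} \<or> I = {a<..<b}"
    using I interior_real_atMost[of b] interior_real_atLeast[of a] interior_atLeastAtMost_real[of a b]
      interior_atLeastLessThan[of a b] interior_lessThanAtMost[of a b] by metis
  then show ?thesis
    using that assms(3) greaterThanLessThan_empty_iff[of a b] by (metis not_le)
qed

section \<open>Densities with the stated conditional densities\<close>

text \<open>As \<open>A * e (A * u + B * |v|)\<close> integrates to 1 in \<open>u\<close>, the
  factor \<open>K\<close> is the density of the difference at \<open>v\<close>. The explicit density
  \<open>e\<close> is kept apart from \<open>f\<close> because the two agree only almost
  everywhere.\<close>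

lemma sum_cond_density_factor:
  fixes A B :: real
  assumes f[measurable]: "f \<in> borel_measurable borel" and e[measurable]: "e \<in> borel_measurable borel"
    and ae: "AE x in lborel. f x = e x"
    and fac: "\<And>u. sum_diff_density e u v = K * (A * e (A * u + B * \<bar>v\<bar>))"
    and "K \<noteq> 0" "0 < A" and int: "(LINT x|lborel. e x) = 1"
  shows "AE u in lborel. sum_cond_density f v u = A * f (A * u + B * \<bar>v\<bar>)"
proof -
  have ae1: "AE u in lborel. sum_diff_density f u v = sum_diff_density e u v"
  proof -
    have "AE u in lborel. f (v / 2 + 1 / 2 * u) = e (v / 2 + 1 / 2 * u)"
      and "AE u in lborel. f (- v / 2 + 1 / 2 * u) = e (- v / 2 + 1 / 2 * u)"
      by (rule AE_lborel_affine[OF ae]; simp)+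
    then show ?thesis
      by eventually_elim (simp add: sum_diff_density_def field_simps)
  qed
  have ae2: "AE u in lborel. f (B * \<bar>v\<bar> + A * u) = e (B * \<bar>v\<bar> + A * u)"
    using \<open>0 < A\<close> by (intro AE_lborel_affine[OF ae]) simp
  have "diff_density f v = (LINT u|lborel. sum_diff_density e u v)"
    unfolding diff_density_def using ae1
    by (intro integral_cong_AE) (auto simp: sum_diff_density_def)
  also have "\<dots> = K * (A * (LINT u|lborel. e (B * \<bar>v\<bar> + A * u)))"
    by (simp add: fac add.commute)
  also have "A * (LINT u|lborel. e (B * \<bar>v\<bar> + A * u)) = 1"
    using lborel_integral_real_affine[of A e "B * \<bar>v\<bar>"] \<open>0 < A\<close> int by simp
  finally have g: "diff_density f v = K" by simp
  show ?thesis
    using ae1 ae2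
  proof eventually_elim
    fix u assume "sum_diff_density f u v = sum_diff_density e u v"
      and "f (B * \<bar>v\<bar> + A * u) = e (B * \<bar>v\<bar> + A * u)"
    then show "sum_cond_density f v u = A * f (A * u + B * \<bar>v\<bar>)"
      using \<open>K \<noteq> 0\<close> \<open>0 < A\<close> by (simp add: sum_cond_density_def g fac add.commute)
  qed
qed

lemma sum_diff_density_uminus:
  "sum_diff_density (\<lambda>x. f (- x)) u v = sum_diff_density f (- u) (- v)"
proof -
  have "- ((u + v) / 2) = (- u + - v) / 2" "- ((u - v) / 2) = (- u - - v) / 2"
    by (simp_all add: field_simps)
  then show ?thesis
    by (simp only: sum_diff_density_def)
qed

text \<open>Both arguments are nonnegative exactly when \<open>|v| \<le> u\<close>, and then the
  exponents add up to \<open>- l * u\<close>.\<close>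

lemma sum_diff_density_exponential:
  assumes "0 < l"
  shows "sum_diff_density (exponential_density l) u v
    = (l / 2 * exp (- l * \<bar>v\<bar>)) * exponential_density l (u - \<bar>v\<bar>)"
proof (cases "\<bar>v\<bar> \<le> u")
  case True
  have "exp (- ((u + v) / 2) * l) * exp (- ((u - v) / 2) * l) = exp (- l * \<bar>v\<bar>) * exp (- (u - \<bar>v\<bar>) * l)"
    unfolding exp_add[symmetric] by (rule arg_cong[where f = exp]) (simp add: field_simps)
  moreover have "\<not> (u + v) / 2 < 0" "\<not> (u - v) / 2 < 0" "\<not> u - \<bar>v\<bar> < 0"
    using True by auto
  ultimately show ?thesis
    by (simp only: sum_diff_density_def exponential_density_def if_False) (simp add: mult_ac)
next
  case False
  then have "(u + v) / 2 < 0 \<or> (u - v) / 2 < 0" "u - \<bar>v\<bar> < 0"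
    by auto
  then show ?thesis
    by (auto simp: sum_diff_density_def exponential_density_def)
qed

text \<open>The squares of \<open>(u + v) / 2\<close> and \<open>(u - v) / 2\<close> add up to
  \<open>(u^2 + v^2) / 2\<close>, so the joint density separates.\<close>

lemma sum_diff_density_normal:
  assumes "0 < \<sigma>"
  shows "sum_diff_density (normal_density 0 \<sigma>) u v
    = exp (- v\<^sup>2 / (4 * \<sigma>\<^sup>2)) / (sqrt 2 * sqrt (2 * pi * \<sigma>\<^sup>2)) *
      (1 / sqrt 2 * normal_density 0 \<sigma> (u / sqrt 2))"
proof -
  have "- ((u + v) / 2)\<^sup>2 / (2 * \<sigma>\<^sup>2) + - ((u - v) / 2)\<^sup>2 / (2 * \<sigma>\<^sup>2) =
      - v\<^sup>2 / (4 * \<sigma>\<^sup>2) + - (u / sqrt 2)\<^sup>2 / (2 * \<sigma>\<^sup>2)"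
    using assms by (simp add: power_divide field_simps power2_eq_square)
  then have "exp (- ((u + v) / 2)\<^sup>2 / (2 * \<sigma>\<^sup>2)) * exp (- ((u - v) / 2)\<^sup>2 / (2 * \<sigma>\<^sup>2)) =
      exp (- v\<^sup>2 / (4 * \<sigma>\<^sup>2)) * exp (- (u / sqrt 2)\<^sup>2 / (2 * \<sigma>\<^sup>2))"
    by (simp add: exp_add[symmetric])
  then show ?thesis
    by (simp add: sum_diff_density_def normal_density_def)
qed

lemma (in prob_space) integral_distributed_eq_1:
  assumes X: "distributed M lborel X e" and e: "\<And>x. 0 \<le> e x"
  shows "(LINT x|lborel. e x) = (1::real)"
  using distributed_integral[OF X, of "\<lambda>_. 1"] e by (simp add: prob_space)

lemma distributed_uminus_lborel:
  fixes X :: "'a \<Rightarrow> real" and f :: "real \<Rightarrow> real"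
  assumes f[measurable]: "f \<in> borel_measurable borel" and X: "distributed M lborel X f"
  shows "distributed M lborel (\<lambda>\<omega>. - X \<omega>) (\<lambda>x. f (- x))"
  unfolding distributed_def
proof (intro conjI)
  have Xm[measurable]: "X \<in> borel_measurable M"
    using distributed_measurable[OF X] by simp
  show "(\<lambda>\<omega>. - X \<omega>) \<in> measurable M lborel" by simp
  show "(\<lambda>x. ennreal (f (- x))) \<in> borel_measurable lborel" by simp
  show "distr M lborel (\<lambda>\<omega>. - X \<omega>) = density lborel (\<lambda>x. ennreal (f (- x)))"
  proof (rule measure_eqI)
    fix C assume "C \<in> sets (distr M lborel (\<lambda>\<omega>. - X \<omega>))"
    then have C[measurable]: "C \<in> sets borel" by simp
    have "emeasure (distr M lborel (\<lambda>\<omega>. - X \<omega>)) C = (\<integral>\<^sup>+ \<omega>. indicator C (- X \<omega>) \<partial>M)"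
      by (subst nn_integral_indicator[symmetric], simp, subst nn_integral_distr) auto
    also have "\<dots> = (\<integral>\<^sup>+ x. ennreal (f x) * indicator C (- x) \<partial>lborel)"
      by (rule distributed_nn_integral[OF X, symmetric]) simp
    also have "\<dots> = (\<integral>\<^sup>+ x. ennreal (f (- x)) * indicator C x \<partial>lborel)"
      by (subst nn_integral_real_affine[where c = "-1" and t = 0]) auto
    also have "\<dots> = emeasure (density lborel (\<lambda>x. ennreal (f (- x)))) C"
      by (simp add: emeasure_density)
    finally show "emeasure (distr M lborel (\<lambda>\<omega>. - X \<omega>)) C = emeasure (density lborel (\<lambda>x. ennreal (f (- x)))) C" .
  qed simp
qed

text \<open>The pairs \<open>(A, B)\<close> are \<open>(1, -1)\<close>, \<open>(1, 1)\<close> and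
  \<open>(1 / sqrt 2, 0)\<close>. Uniqueness of densities identifies \<open>f\<close> with the
  explicit density almost everywhere.\<close>

lemma (in prob_space) cond_density_if:
  fixes f :: "real \<Rightarrow> real" and X :: "'a \<Rightarrow> real"
  assumes f[measurable]: "f \<in> borel_measurable borel" and nonneg: "\<And>x. 0 \<le> f x"
    and X: "distributed M lborel X f"
    and D: "(\<exists>l>0. distributed M lborel X (exponential_density l)) \<or>
         (\<exists>l>0. distributed M lborel (\<lambda>\<omega>. - X \<omega>) (exponential_density l)) \<or>
         (\<exists>\<sigma>>0. distributed M lborel X (normal_density 0 \<sigma>))"
  shows "\<exists>A B :: real. 0 < A \<and>
    (\<forall>v. AE u in lborel. sum_cond_density f v u = A * f (A * u + B * \<bar>v\<bar>))"
  using D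
proof (elim disjE exE conjE)
  fix l :: real assume l: "0 < l" and E: "distributed M lborel X (exponential_density l)"
  have "AE u in lborel. sum_cond_density f v u = 1 * f (1 * u + (-1) * \<bar>v\<bar>)" for v
  proof (rule sum_cond_density_factor[where e = "exponential_density l"])
    show "AE x in lborel. f x = exponential_density l x"
      using distributed_unique[OF X E] nonneg exponential_density_nonneg[OF l] by simp
    show "(LINT x|lborel. exponential_density l x) = 1"
      using integral_distributed_eq_1[OF E] exponential_density_nonneg[OF l] by simp
    show "sum_diff_density (exponential_density l) u v =
        (l / 2 * exp (- l * \<bar>v\<bar>)) * (1 * exponential_density l (1 * u + (-1) * \<bar>v\<bar>))" for u
      using sum_diff_density_exponential[OF l, of u v] by simp
  qed (use l in auto)
  then show ?thesis
    using zero_less_one by blast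
next
  fix l :: real assume l: "0 < l" and E: "distributed M lborel (\<lambda>\<omega>. - X \<omega>) (exponential_density l)"
  have X': "distributed M lborel (\<lambda>\<omega>. - X \<omega>) (\<lambda>x. f (- x))"
    using X by (rule distributed_uminus_lborel[OF f])
  have "AE u in lborel. sum_cond_density f v u = 1 * f (1 * u + 1 * \<bar>v\<bar>)" for v
  proof (rule sum_cond_density_factor[where e = "\<lambda>x. exponential_density l (- x)"])
    have "AE x in lborel. f (- x) = exponential_density l x"
      using distributed_unique[OF X' E] nonneg exponential_density_nonneg[OF l] by simp
    from AE_lborel_affine[OF this, where c = "-1" and t = 0]
    show "AE x in lborel. f x = exponential_density l (- x)" by simp
    show "(LINT x|lborel. exponential_density l (- x)) = 1"
    proof -
      have "(LINT x|lborel. exponential_density l x) = \<bar>- 1\<bar> *\<^sub>R (LINT x|lborel. exponential_density l (0 + - 1 * x))"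
        by (rule lborel_integral_real_affine) simp
      moreover have "(LINT x|lborel. exponential_density l x) = 1"
        using integral_distributed_eq_1[OF E] exponential_density_nonneg[OF l] by blast
      ultimately show ?thesis
        unfolding abs_minus abs_one scaleR_one add_0 mult_minus1 by argo
    qed
    show "sum_diff_density (\<lambda>x. exponential_density l (- x)) u v =
        (l / 2 * exp (- l * \<bar>v\<bar>)) * (1 * exponential_density l (- (1 * u + 1 * \<bar>v\<bar>)))" for u
      unfolding sum_diff_density_uminus sum_diff_density_exponential[OF l] by simp
  qed (use l in auto)
  then show ?thesis
    using zero_less_one by blast
next
  fix \<sigma> :: real assume s: "0 < \<sigma>" and E: "distributed M lborel X (normal_density 0 \<sigma>)"
  have "AE u in lborel. sum_cond_density f v u = 1 / sqrt 2 * f (1 / sqrt 2 * u + 0 * \<bar>v\<bar>)" for v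
  proof (rule sum_cond_density_factor[where e = "normal_density 0 \<sigma>"])
    show "AE x in lborel. f x = normal_density 0 \<sigma> x"
      using distributed_unique[OF X E] nonneg by simp
    show "(LINT x|lborel. normal_density 0 \<sigma> x) = 1"
      using s by simp
    show "sum_diff_density (normal_density 0 \<sigma>) u v =
      exp (- v\<^sup>2 / (4 * \<sigma>\<^sup>2)) / (sqrt 2 * sqrt (2 * pi * \<sigma>\<^sup>2)) *
        (1 / sqrt 2 * normal_density 0 \<sigma> (1 / sqrt 2 * u + 0 * \<bar>v\<bar>))" for u
      using sum_diff_density_normal[OF s, of u v] by simp
  qed (use s in auto)
  moreover have "0 < 1 / sqrt (2 :: real)" by simp
  ultimately show ?thesis by blast
qed

section \<open>The functional equation\<close>

text \<open>The constant \<open>k v\<close> stands for \<open>2 * A * diff_density f v\<close>; only its positivity matters.\<close>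

locale sum_diff_equation =
  fixes f :: "real \<Rightarrow> real" and I :: "real set" and A B :: real and k :: "real \<Rightarrow> real"
  assumes measurable_f[measurable]: "f \<in> borel_measurable borel"
    and pos: "\<And>x. x \<in> I \<Longrightarrow> 0 < f x"
    and zero: "\<And>x. x \<notin> I \<Longrightarrow> f x = 0"
    and prob: "prob_space (density lborel f)"
    and A_pos: "0 < A"
    and k_pos: "\<And>v. ennreal \<bar>v\<bar> < emeasure lborel I \<Longrightarrow> 0 < k v"
    and eq: "\<And>v. ennreal \<bar>v\<bar> < emeasure lborel I \<Longrightarrow>
      AE u in lborel. f ((u + v) / 2) * f ((u - v) / 2) = k v * f (A * u + B * \<bar>v\<bar>)"
begin

abbreviation "D \<equiv> density lborel (\<lambda>x. ennreal (f x))"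

sublocale D: prob_space D
  by (rule prob)

sublocale D: real_distribution D
  by standard simp

lemma nonneg: "0 \<le> f x"
  using pos[of x] zero[of x] by (cases "x \<in> I") auto

text \<open>Since \<open>f\<close> vanishes exactly off \<open>I\<close> and
  \<open>k v \<noteq> 0\<close>, the two sides of the equation are nonzero at the same points. The
  endpoints of \<open>I\<close> are compared through this.\<close>

lemma AE_support:
  assumes "ennreal \<bar>v\<bar> < emeasure lborel I"
  shows "AE u in lborel. (u + v) / 2 \<in> I \<and> (u - v) / 2 \<in> I \<longleftrightarrow> A * u + B * \<bar>v\<bar> \<in> I"
  using eq[OF assms]
proof eventually_elim
  fix u assume u: "f ((u + v) / 2) * f ((u - v) / 2) = k v * f (A * u + B * \<bar>v\<bar>)"
  have I: "x \<in> I \<longleftrightarrow> f x \<noteq> 0" for x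
    using pos[of x] zero[of x] by auto
  show "(u + v) / 2 \<in> I \<and> (u - v) / 2 \<in> I \<longleftrightarrow> A * u + B * \<bar>v\<bar> \<in> I"
    unfolding I using u k_pos[OF assms] by (metis mult_eq_0_iff less_irrefl)
qed

text \<open>The left side is supported on a \<open>u\<close>-interval of length
  \<open>2 * (b - a) - 2 * v\<close>, the right side on one of length \<open>(b - a) / A\<close>;
  these cannot agree for two different values of \<open>v\<close>.\<close>

lemma not_bounded:
  assumes "a < b" and I: "I = {a<..<b}"
  shows False
proof -
  define c where "c = (b - a) / 2"
  have c: "0 < c" "a + b = 2 * a + 2 * c"
    using \<open>a < b\<close> by (auto simp: c_def field_simps)
  have supp: "2 * a + v = (a - B * v) / A" "2 * b - v = (b - B * v) / A" if "v = 0 \<or> v = c" for v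
  proof -
    have v: "0 \<le> v" "v < b - a"
      using that \<open>a < b\<close> by (auto simp: c_def field_simps)
    then have "ennreal \<bar>v\<bar> < emeasure lborel I"
      using \<open>a < b\<close> by (simp add: I ennreal_less_iff)
    from AE_support[OF this]
    have "AE u in lborel. 2 * a + v < u \<and> u < 2 * b - v \<longleftrightarrow> (a - B * v) / A < u \<and> u < (b - B * v) / A"
    proof eventually_elim
      fix u assume "(u + v) / 2 \<in> I \<and> (u - v) / 2 \<in> I \<longleftrightarrow> A * u + B * \<bar>v\<bar> \<in> I"
      then show "2 * a + v < u \<and> u < 2 * b - v \<longleftrightarrow> (a - B * v) / A < u \<and> u < (b - B * v) / A"
        using v A_pos by (auto simp: I field_simps)
    qed
    then show "2 * a + v = (a - B * v) / A" "2 * b - v = (b - B * v) / A"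
      by (rule AE_eq_Ioo_imp; use v in simp)+
  qed
  have "2 * a = a / A" "2 * b = b / A" "2 * a + c = a / A - B * c / A" "2 * b - c = b / A - B * c / A"
    using supp[of 0] supp[of c] by (simp_all add: diff_divide_distrib)
  then show False
    using c(1) by linarith
qed

text \<open>Substituting \<open>x + v\<close> for \<open>x\<close> turns an almost-everywhere
  relation for \<open>f\<close> into an exact one for the tails. Both the half-line and the whole
  line use it.\<close>

lemma measure_Ioi_shift:
  assumes ae: "AE x in lborel. t < x \<longrightarrow> f (x + v) = c * f x" and "0 \<le> c"
  shows "measure D {t + v<..} = c * measure D {t<..}"
proof -
  have "emeasure D {t + v<..} = (\<integral>\<^sup>+ x. ennreal (f x) * indicator {t + v<..} x \<partial>lborel)"
    by (simp add: emeasure_density)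
  also have "\<dots> = (\<integral>\<^sup>+ x. ennreal (f (x + v)) * indicator {t<..} x \<partial>lborel)"
    by (subst nn_integral_real_affine[where c = 1 and t = v])
       (auto intro!: nn_integral_cong simp: indicator_def add.commute)
  also have "\<dots> = (\<integral>\<^sup>+ x. ennreal c * (ennreal (f x) * indicator {t<..} x) \<partial>lborel)"
  proof (rule nn_integral_cong_AE, use ae in eventually_elim)
    fix x assume "t < x \<longrightarrow> f (x + v) = c * f x"
    then show "ennreal (f (x + v)) * indicator {t<..} x = ennreal c * (ennreal (f x) * indicator {t<..} x)"
      using \<open>0 \<le> c\<close> nonneg by (auto simp: indicator_def ennreal_mult)
  qed
  also have "\<dots> = ennreal c * emeasure D {t<..}"
    by (simp add: nn_integral_cmult emeasure_density)
  finally have "ennreal (measure D {t + v<..}) = ennreal (c * measure D {t<..})"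
    using \<open>0 \<le> c\<close> by (simp add: D.emeasure_eq_measure ennreal_mult)
  then show ?thesis
    using \<open>0 \<le> c\<close> by simp
qed

end

text \<open>Cauchy's equation for the monotone function \<open>- ln T\<close>: monotonicity bounds
  the deviation from linearity at \<open>x\<close> by \<open>L 1 / n\<close> for every positive
  \<open>n\<close>.\<close>

lemma multiplicative_antimono_imp_exp:
  fixes T :: "real \<Rightarrow> real"
  assumes mult: "\<And>v w. 0 \<le> v \<Longrightarrow> 0 \<le> w \<Longrightarrow> T (v + w) = T v * T w"
    and pos: "\<And>v. 0 \<le> v \<Longrightarrow> 0 < T v"
    and mono: "\<And>v w. 0 \<le> v \<Longrightarrow> v \<le> w \<Longrightarrow> T w \<le> T v"
    and x: "0 \<le> x"
  shows "T x = exp (ln (T 1) * x)"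
proof -
  define L where "L v = - ln (T v)" for v
  have add: "L (v + w) = L v + L w" if "0 \<le> v" "0 \<le> w" for v w
    using that pos[of v] pos[of w] by (simp add: L_def mult ln_mult)
  have mono': "L v \<le> L w" if "0 \<le> v" "v \<le> w" for v w
    using that by (simp add: L_def mono pos)
  have nat_mult: "L (real n * v) = real n * L v" if "0 \<le> v" for n v
  proof (induction n)
    case 0
    show ?case using add[of 0 0] by simp
  next
    case (Suc n)
    then show ?case using add[of "real n * v" v] that by (simp add: algebra_simps)
  qed
  have L1: "0 \<le> L 1"
    using mono'[of 0 1] add[of 0 0] by simp
  \<comment> \<open>With \<open>m\<close> the floor of \<open>n * x\<close>, both
    \<open>n * L x\<close> and \<open>n * x * L 1\<close> lie between \<open>m * L 1\<close> and
    \<open>(m + 1) * L 1\<close>.\<close>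
  have close: "real n * \<bar>L x - x * L 1\<bar> \<le> L 1" for n
  proof -
    define m where "m = nat \<lfloor>real n * x\<rfloor>"
    have m: "real m \<le> real n * x" "real n * x \<le> real m + 1"
      using x by (auto simp: m_def)
    have "real m * L 1 \<le> real n * L x" "real n * L x \<le> (real m + 1) * L 1"
      using mono'[of "real m * 1" "real n * x"] mono'[of "real n * x" "real (Suc m) * 1"]
        nat_mult[of 1 m] nat_mult[of 1 "Suc m"] nat_mult[of x n] m x
      by (simp_all add: add.commute)
    moreover have "real m * L 1 \<le> real n * x * L 1" "real n * x * L 1 \<le> (real m + 1) * L 1"
      using m L1 by (auto intro: mult_right_mono)
    ultimately have "\<bar>real n * L x - real n * x * L 1\<bar> \<le> L 1"
      by (simp add: algebra_simps abs_le_iff)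
    moreover have "real n * \<bar>L x - x * L 1\<bar> = \<bar>real n * L x - real n * x * L 1\<bar>"
      by (simp add: abs_mult mult.assoc flip: right_diff_distrib)
    ultimately show ?thesis by simp
  qed
  have "L x = x * L 1"
  proof (rule ccontr)
    assume "L x \<noteq> x * L 1"
    then obtain n where "L 1 < real n * \<bar>L x - x * L 1\<bar>"
      using reals_Archimedean3[of "\<bar>L x - x * L 1\<bar>"] by auto
    with close[of n] show False by simp
  qed
  then have "ln (T x) = ln (T 1) * x"
    by (simp add: L_def mult.commute)
  then show ?thesis
    using exp_ln[OF pos[OF x]] by metis
qed

section \<open>Half-lines: exponential tails\<close>

context sum_diff_equation
begin

text \<open>Passing from \<open>f\<close> to its tail function supplies the monotonicity under which
  a multiplicative function is exponential.\<close>

lemma half_line: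
  assumes I: "I = {a<..}"
  shows "a = 0 \<and> (\<exists>l>0. \<forall>t\<ge>0. measure D {t<..} = exp (- t * l))"
proof -
  have inf: "ennreal \<bar>v\<bar> < emeasure lborel I" for v
    by (simp add: I ennreal_less_emeasure_half_line)
  \<comment> \<open>These are the left endpoints of the supports in \<open>u\<close> of the two
    sides.\<close>
  have supp: "2 * a + v = (a - B * v) / A" if "0 \<le> v" for v
  proof (rule AE_eq_Ioi_imp, use AE_support[OF inf[of v]] in eventually_elim)
    fix u assume "(u + v) / 2 \<in> I \<and> (u - v) / 2 \<in> I \<longleftrightarrow> A * u + B * \<bar>v\<bar> \<in> I"
    then show "2 * a + v < u \<longleftrightarrow> (a - B * v) / A < u"
      using that A_pos by (auto simp: I field_simps)
  qed
  have aA: "2 * a = a / A"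
    using supp[of 0] by simp
  then have "- B / A = 1"
    using supp[of 1] by (simp add: diff_divide_distrib)
  then have BA: "B = - A"
    using A_pos by (simp add: field_simps)
  \<comment> \<open>Substitute \<open>u = v + 2 * x\<close>. Because \<open>B = - A\<close>, the
    argument on the right no longer depends on \<open>v\<close>.\<close>
  have fe: "AE x in lborel. f (x + v) * f x = k v * f (2 * A * x)" if "0 \<le> v" for v
  proof -
    have "AE x in lborel. f ((v + 2 * x + v) / 2) * f ((v + 2 * x - v) / 2) = k v * f (A * (v + 2 * x) + B * \<bar>v\<bar>)"
      by (rule AE_lborel_affine[OF eq[OF inf]]) simp
    then show ?thesis
    proof eventually_elim
      fix x assume x: "f ((v + 2 * x + v) / 2) * f ((v + 2 * x - v) / 2) = k v * f (A * (v + 2 * x) + B * \<bar>v\<bar>)"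
      have "(v + 2 * x + v) / 2 = x + v" "(v + 2 * x - v) / 2 = x" "A * (v + 2 * x) + B * \<bar>v\<bar> = 2 * A * x"
        using that by (auto simp: BA algebra_simps)
      with x show "f (x + v) * f x = k v * f (2 * A * x)"
        by metis
    qed
  qed
  define c where "c v = k v / k 0" for v
  have c_pos: "0 < c v" for v
    using k_pos[OF inf] by (simp add: c_def)
  \<comment> \<open>The case \<open>v = 0\<close> eliminates \<open>f (2 * A * x)\<close>; then a
    factor \<open>f x\<close>, positive beyond \<open>a\<close>, cancels.\<close>
  have shift: "AE x in lborel. a < x \<longrightarrow> f (x + v) = c v * f x" if "0 \<le> v" for v
    using fe[OF that] fe[OF order_refl]
  proof eventually_elim
    fix x assume x: "f (x + v) * f x = k v * f (2 * A * x)" "f (x + 0) * f x = k 0 * f (2 * A * x)"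
    have "k 0 * (f (x + v) * f x) = k v * (f x * f x)"
      using x by simp
    then have "f x \<noteq> 0 \<Longrightarrow> k 0 * f (x + v) = k v * f x"
      by (simp add: mult.left_commute mult.assoc[symmetric])
    then show "a < x \<longrightarrow> f (x + v) = c v * f x"
      using pos[of x] k_pos[OF inf, of 0] by (auto simp: I c_def field_simps)
  qed
  define T where "T v = measure D {a + v<..}" for v
  have "x \<in> {a<..}" if "0 < f x" for x
    using zero[of x] that by (auto simp: I)
  then have "AE x in D. x \<in> {a<..}"
    by (simp add: AE_density)
  then have T0: "T 0 = 1"
    by (simp add: T_def D.prob_eq_1)
  have T_shift: "T (w + v) = c v * T w" if "0 \<le> v" "0 \<le> w" for v w
  proof -
    have "AE x in lborel. a + w < x \<longrightarrow> f (x + v) = c v * f x"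
      using shift[OF that(1)] by eventually_elim (use that in auto)
    from measure_Ioi_shift[OF this less_imp_le[OF c_pos]] show ?thesis
      by (simp add: T_def add.assoc)
  qed
  have T_c: "T v = c v" if "0 \<le> v" for v
    using T_shift[OF that order_refl] T0 by simp
  have exp: "T v = exp (ln (T 1) * v)" if "0 \<le> v" for v
  proof (rule multiplicative_antimono_imp_exp[OF _ _ _ that])
    show "T (v + w) = T v * T w" if "0 \<le> v" "0 \<le> w" for v w
      using T_shift[OF that(2,1)] T_c[OF that(2)] by simp
    show "0 < T v" if "0 \<le> v" for v
      using T_c[OF that] c_pos by simp
    show "T w \<le> T v" if "0 \<le> v" "v \<le> w" for v w
      unfolding T_def using that by (intro D.finite_measure_mono) auto
  qed
  \<comment> \<open>Otherwise \<open>(a, a + 1)\<close> would carry no mass although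
    \<open>f\<close> is positive there. This makes the rate strictly positive.\<close>
  have "T 1 \<noteq> 1"
  proof
    assume "T 1 = 1"
    then have "AE x in D. x \<in> {a + 1<..}"
      by (simp add: T_def D.prob_eq_1)
    then have "AE x in lborel. 0 < f x \<longrightarrow> a + 1 < x"
      by (simp add: AE_density)
    from not_AE_lborel_Ioo[OF this, of a "a + 1"] show False
      using pos by (simp add: I)
  qed
  moreover have "T 1 \<le> 1"
    by (simp add: T_def)
  ultimately have l: "0 < - ln (T 1)"
    using T_c[of 1] c_pos[of 1] by simp
  have "a = 0"
  proof (rule ccontr)
    assume "a \<noteq> 0"
    then have A: "2 * A = 1"
      using aA A_pos by (simp add: field_simps)
    have const: "AE x in lborel. a < x \<longrightarrow> f x = k 0"
      using fe[OF order_refl]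
    proof eventually_elim
      fix x assume "f (x + 0) * f x = k 0 * f (2 * A * x)"
      then show "a < x \<longrightarrow> f x = k 0"
        using pos[of x] by (auto simp: I A)
    qed
    then have "AE x in lborel. a < 1 + 1 * x \<longrightarrow> f (1 + 1 * x) = k 0"
      by (rule AE_lborel_affine) simp
    \<comment> \<open>A density constant beyond \<open>a\<close> is invariant under the shift by 1,
      so that \<open>T 1 = T 0\<close>.\<close>
    with const have "AE x in lborel. a < x \<longrightarrow> f (x + 1) = 1 * f x"
    proof eventually_elim
      fix x assume "a < x \<longrightarrow> f x = k 0" "a < 1 + 1 * x \<longrightarrow> f (1 + 1 * x) = k 0"
      then show "a < x \<longrightarrow> f (x + 1) = 1 * f x"
        by (simp add: add.commute)
    qed
    from measure_Ioi_shift[OF this] have "T 1 = T 0"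
      by (simp add: T_def)
    with \<open>T 1 \<noteq> 1\<close> T0 show False by simp
  qed
  moreover have "measure D {t<..} = exp (- t * - ln (T 1))" if "0 \<le> t" for t
    using exp[OF that] \<open>a = 0\<close> by (simp add: T_def mult.commute)
  ultimately show ?thesis
    using l by blast
qed

end

section \<open>The whole line\<close>

text \<open>The parallelogram law gives \<open>q (n * s) = n^2 * q s\<close> by a two-step
  induction, hence the claim at rational points; the set where the two continuous functions agree is
  closed.\<close>

lemma quadratic_eq_continuous:
  fixes q :: "real \<Rightarrow> real"
  assumes cont: "continuous_on UNIV q"
    and eq: "\<And>s t. q (s + t) + q (s - t) = 2 * q s + 2 * q t"
  shows "q s = q 1 * s\<^sup>2"
proof -
  have 0: "q 0 = 0"
    using eq[of 0 0] by simp
  have even: "q (- s) = q s" for s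
    using eq[of 0 s] 0 by simp
  have nat_mult: "q (real n * s) = (real n)\<^sup>2 * q s" for n s
  proof (induction n rule: less_induct)
    case (less n)
    consider "n = 0" | "n = 1" | m where "n = Suc (Suc m)"
      by (metis One_nat_def not0_implies_Suc)
    then show ?case
    proof cases
      case 3
      have "q (real (Suc m) * s + s) + q (real (Suc m) * s - s) = 2 * q (real (Suc m) * s) + 2 * q s"
        by (rule eq)
      moreover have "real (Suc m) * s + s = real n * s" "real (Suc m) * s - s = real m * s"
        using 3 by (auto simp: algebra_simps)
      ultimately have "q (real n * s) = 2 * q (real (Suc m) * s) + 2 * q s - q (real m * s)"
        by simp
      also have "\<dots> = 2 * ((real (Suc m))\<^sup>2 * q s) + 2 * q s - (real m)\<^sup>2 * q s"
        using less[of m] less[of "Suc m"] 3 by simp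
      also have "\<dots> = (real n)\<^sup>2 * q s"
        by (simp add: 3 power2_eq_square algebra_simps)
      finally show ?thesis .
    qed (simp_all add: 0)
  qed
  have int_mult: "q (real_of_int n * s) = (real_of_int n)\<^sup>2 * q s" for n s
  proof (cases n)
    case (nonneg m)
    then show ?thesis using nat_mult[of m s] by simp
  next
    case (neg m)
    then have "real_of_int n = - real (Suc m)" by simp
    then show ?thesis
      using nat_mult[of "Suc m" s] even[of "real (Suc m) * s"] by (simp del: of_nat_Suc)
  qed
  have "q r = q 1 * r\<^sup>2" if "r \<in> \<rat>" for r
  proof -
    from that obtain m n :: int where n: "n > 0" and r: "r = real_of_int m / real_of_int n"
      by (rule Rats_cases')
    have "real_of_int n * r = real_of_int m * 1"
      using n r by simp
    then have "(real_of_int n)\<^sup>2 * q r = (real_of_int m)\<^sup>2 * q 1"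
      using int_mult[of n r] int_mult[of m 1] by simp
    then show ?thesis
      using n unfolding r power_divide by (simp add: eq_divide_eq mult.commute)
  qed
  moreover have "continuous_on UNIV (\<lambda>r. q 1 * r\<^sup>2)"
    by (intro continuous_intros)
  then have "closed {r. q r = q 1 * r\<^sup>2}"
    by (rule closed_Collect_eq[OF cont])
  ultimately have "closure \<rat> \<subseteq> {r. q r = q 1 * r\<^sup>2}"
    by (intro closure_minimal) blast+
  then show ?thesis
    unfolding Rats_closure_real by blast
qed

text \<open>Modulus and phase are treated separately. The function \<open>- ln |\<phi>|\<close>
  obeys the parallelogram law, hence is quadratic; the phase \<open>\<theta>\<close> is invariant
  under scaling by \<open>sqrt 2\<close>, hence equals its value at 0.\<close>

lemma centered_normal_char:
  fixes \<phi> :: "real \<Rightarrow> complex"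
  assumes cont: "continuous_on UNIV \<phi>" and zero: "\<phi> 0 = 1"
    and cnj: "\<And>t. \<phi> (- t) = cnj (\<phi> t)"
    and le_1: "norm (\<phi> 1) < 1"
    and "0 < A"
    and scale: "\<And>s. \<phi> (A * s) ^ 2 = \<phi> s"
    and eq: "\<And>s t. \<phi> (s + t) * \<phi> (s - t) = \<phi> s ^ 2 * (\<phi> t * \<phi> (- t))"
  shows "\<exists>\<sigma>>0. \<forall>s. \<phi> s = complex_of_real (exp (- (\<sigma> * s)\<^sup>2 / 2))"
proof -
  \<comment> \<open>Used with \<open>c = 2\<close> to exclude zeros and with
    \<open>c = sqrt 2\<close> for the phase.\<close>
  have half: "(\<lambda>n. \<theta> (s / c ^ n)) \<longlonglongrightarrow> \<theta> 0"
    if "continuous_on UNIV \<theta>" "1 < c" for \<theta> :: "real \<Rightarrow> complex" and s c :: real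
  proof -
    have "(\<lambda>n. s * inverse (c ^ n)) \<longlonglongrightarrow> s * 0"
      by (intro tendsto_intros LIMSEQ_inverse_realpow_zero that)
    then have "(\<lambda>n. s / c ^ n) \<longlonglongrightarrow> 0"
      by (simp add: divide_inverse)
    moreover have "isCont \<theta> 0"
      using that(1) by (simp add: continuous_on_eq_continuous_at)
    ultimately show ?thesis
      by (rule isCont_tendsto_compose[rotated])
  qed
  have eqR: "norm (\<phi> (s + t)) * norm (\<phi> (s - t)) = norm (\<phi> s) ^ 2 * norm (\<phi> t) ^ 2" for s t
    using arg_cong[OF eq[of s t], of norm] by (simp add: norm_mult norm_power cnj power2_eq_square)
  \<comment> \<open>By \<open>|\<phi> (2 * r)| = |\<phi> r|^4\<close> a zero at \<open>s\<close>
    passes to every \<open>s / 2 ^ n\<close>, and by continuity to 0, where \<open>\<phi>\<close> is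
    1.\<close>
  have nz: "\<phi> s \<noteq> 0" for s
  proof
    assume s: "\<phi> s = 0"
    have "\<phi> (s / 2 ^ n) = 0" for n
    proof (induction n)
      case (Suc n)
      have "norm (\<phi> (s / 2 ^ Suc n + s / 2 ^ Suc n)) = norm (\<phi> (s / 2 ^ Suc n)) ^ 4"
        using eqR[of "s / 2 ^ Suc n" "s / 2 ^ Suc n"] by (simp add: zero)
      then show ?case
        using Suc by (simp add: field_simps)
    qed (use s in simp)
    then have "(\<lambda>n. 0) \<longlonglongrightarrow> \<phi> 0"
      using half[OF cont, of 2 s] by simp
    then show False
      using LIMSEQ_unique[OF _ tendsto_const] zero by (metis zero_neq_one)
  qed
  define q where "q s = - ln (norm (\<phi> s))" for s
  have "continuous_on UNIV q"
    unfolding q_def using nz by (intro continuous_intros cont) auto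
  moreover have "q (s + t) + q (s - t) = 2 * q s + 2 * q t" for s t
    using arg_cong[OF eqR[of s t], of ln] nz by (simp add: q_def ln_mult ln_realpow)
  ultimately have q: "q s = q 1 * s\<^sup>2" for s
    by (rule quadratic_eq_continuous)
  have q1: "0 < q 1"
    using le_1 nz[of 1] by (simp add: q_def)
  have R: "norm (\<phi> s) = exp (- q 1 * s\<^sup>2)" for s
    using q[of s] nz[of s] by (simp add: q_def) (metis exp_ln minus_minus zero_less_norm_iff)
  \<comment> \<open>Comparing exponents in the modulus of \<open>scale\<close> at 1 determines
    \<open>A = 1 / sqrt 2\<close>.\<close>
  have "norm (\<phi> (A * 1)) ^ 2 = norm (\<phi> 1)"
    using arg_cong[OF scale[of 1], of norm] by (simp add: norm_power)
  then have "2 * (q 1 * A\<^sup>2) = q 1"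
    by (simp add: R power2_eq_square mult_exp_exp)
  then have "(2 * A)\<^sup>2 = 2"
    using q1 by (simp add: power_mult_distrib)
  then have A: "2 * A = sqrt 2"
    using \<open>0 < A\<close> by (metis less_eq_real_def mult_pos_pos real_sqrt_unique zero_less_numeral)
  define \<theta> where "\<theta> s = \<phi> s / norm (\<phi> s)" for s
  have \<theta>_cont: "continuous_on UNIV \<theta>"
    unfolding \<theta>_def using nz by (intro continuous_intros cont) auto
  have \<theta>_inv: "\<theta> s * \<theta> (- s) = 1" for s
    using nz[of s] complex_norm_square[of "\<phi> s"] by (simp add: \<theta>_def cnj power2_eq_square)
  have \<theta>_norm: "norm (\<phi> (- t)) = norm (\<phi> t)" for t
    by (simp add: cnj)
  have \<theta>_double: "\<theta> (2 * s) = \<theta> s ^ 2" for s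
  proof -
    have "\<theta> (s + s) * \<theta> (s - s) = \<theta> s ^ 2 * (\<theta> s * \<theta> (- s))"
      unfolding \<theta>_def times_divide_times_eq power_divide eq[of s s]
        of_real_mult[symmetric] eqR[of s s] \<theta>_norm of_real_power[symmetric]
      by (simp add: power2_eq_square)
    moreover have "\<theta> 0 = 1"
      by (simp add: \<theta>_def zero)
    ultimately show ?thesis
      by (simp add: \<theta>_inv)
  qed
  have \<theta>_scale: "\<theta> (A * s) ^ 2 = \<theta> s" for s
  proof -
    have "norm (\<phi> (A * s)) ^ 2 = norm (\<phi> s)"
      using arg_cong[OF scale[of s], of norm] by (simp add: norm_power)
    then show ?thesis
      unfolding \<theta>_def power_divide of_real_power[symmetric] scale by simp
  qed
  have \<theta>_sqrt: "\<theta> (sqrt 2 * s) = \<theta> s" for s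
    using \<theta>_double[of "A * s"] \<theta>_scale[of s] by (simp add: A[symmetric] mult.assoc)
  have "\<theta> s = 1" for s
  proof -
    have "\<theta> (s / sqrt 2 ^ n) = \<theta> s" for n
    proof (induction n)
      case (Suc n)
      then show ?case
        using \<theta>_sqrt[of "s / sqrt 2 ^ Suc n"] by simp
    qed simp
    then have "(\<lambda>n. \<theta> s) \<longlonglongrightarrow> \<theta> 0"
      using half[OF \<theta>_cont, of "sqrt 2" s] by simp
    then show ?thesis
      using LIMSEQ_unique[OF _ tendsto_const] by (fastforce simp: \<theta>_def zero)
  qed
  then have "\<phi> s = norm (\<phi> s)" for s
    using nz[of s] by (simp add: \<theta>_def)
  \<comment> \<open>The deviation \<open>sqrt (2 * q 1)\<close> is chosen so that half its square is
    \<open>q 1\<close>.\<close>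
  then have "\<phi> s = complex_of_real (exp (- (sqrt (2 * q 1) * s)\<^sup>2 / 2))" for s
    using q1 unfolding R by (simp add: power_mult_distrib)
  moreover have "0 < sqrt (2 * q 1)"
    using q1 by simp
  ultimately show ?thesis by blast
qed

section \<open>The equation on the whole line: vanishing of \<open>B\<close> and the characteristic
  function\<close>

context sum_diff_equation
begin

text \<open>A nonzero \<open>d = B / A\<close> would give \<open>S (t + 2 * d) = c * S t\<close> for
  the tail function \<open>S\<close>. The limit 1 at minus infinity forces \<open>c = 1\<close>, and
  a periodic positive \<open>S\<close> cannot tend to 0.\<close>

lemma whole_line_B_eq_0:
  assumes I: "I = UNIV"
  shows "B = 0"
proof (rule ccontr)
  assume "B \<noteq> 0"
  define d where "d = B / A"
  have Ad: "A * d = B" "d \<noteq> 0"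
    using A_pos \<open>B \<noteq> 0\<close> by (auto simp: d_def)
  have inf: "ennreal \<bar>v\<bar> < emeasure lborel I" for v
    by (simp add: I)
  have fpos: "0 < f x" for x
    using pos by (simp add: I)
  define G where "G w = k (2 * w) / k 0" for w
  have G_pos: "0 < G w" for w
    using k_pos[OF inf] by (simp add: G_def)
  \<comment> \<open>Substitute \<open>u = 2 * x\<close> and \<open>v = 2 * w\<close>.\<close>
  have fe: "AE x in lborel. f (x + w) * f (x - w) = k (2 * w) * f (2 * A * x + 2 * B * w)" if "0 \<le> w" for w
  proof -
    have "AE x in lborel. f ((0 + 2 * x + 2 * w) / 2) * f ((0 + 2 * x - 2 * w) / 2) =
        k (2 * w) * f (A * (0 + 2 * x) + B * \<bar>2 * w\<bar>)"
      by (rule AE_lborel_affine[OF eq[OF inf]]) simp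
    then show ?thesis
    proof eventually_elim
      fix x assume x: "f ((0 + 2 * x + 2 * w) / 2) * f ((0 + 2 * x - 2 * w) / 2) =
        k (2 * w) * f (A * (0 + 2 * x) + B * \<bar>2 * w\<bar>)"
      have "(0 + 2 * x + 2 * w) / 2 = x + w" "(0 + 2 * x - 2 * w) / 2 = x - w"
        "A * (0 + 2 * x) + B * \<bar>2 * w\<bar> = 2 * A * x + 2 * B * w"
        using that by (auto simp: field_simps)
      with x show "f (x + w) * f (x - w) = k (2 * w) * f (2 * A * x + 2 * B * w)"
        by metis
    qed
  qed
  \<comment> \<open>As \<open>A * d = B\<close>, the equation for \<open>w = 0\<close> taken at
    \<open>x + d * w\<close> has the same \<open>f\<close>-value on its right side.\<close>
  have fe': "AE x in lborel. f (x + w) * f (x - w) = G w * f (x + d * w) ^ 2" if "0 \<le> w" for w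
  proof -
    have "AE x in lborel. f (d * w + 1 * x + 0) * f (d * w + 1 * x - 0) =
        k (2 * 0) * f (2 * A * (d * w + 1 * x) + 2 * B * 0)"
      by (rule AE_lborel_affine[OF fe]) simp_all
    with fe[OF that] show ?thesis
    proof eventually_elim
      fix x
      assume x: "f (x + w) * f (x - w) = k (2 * w) * f (2 * A * x + 2 * B * w)"
        and y: "f (d * w + 1 * x + 0) * f (d * w + 1 * x - 0) = k (2 * 0) * f (2 * A * (d * w + 1 * x) + 2 * B * 0)"
      have "2 * A * (d * w + 1 * x) + 2 * B * 0 = 2 * A * x + 2 * B * w"
        using Ad by (simp add: algebra_simps)
      then have "f (x + d * w) ^ 2 = k 0 * f (2 * A * x + 2 * B * w)"
        using y by (simp add: power2_eq_square add.commute)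
      then show "f (x + w) * f (x - w) = G w * f (x + d * w) ^ 2"
        using x k_pos[OF inf, of 0] by (simp add: G_def)
    qed
  qed
  define c where "c = sqrt (G 2) / G 1 ^ 2"
  have c_pos: "0 < c"
    using G_pos[of 1] G_pos[of 2] by (simp add: c_def)
  \<comment> \<open>Multiply the equations with increment 1 centred at \<open>x + 1\<close> and \<open>x - 1\<close>: the factors
    \<open>f (x + 2) * f (x - 2)\<close> and \<open>f (x + d + 1) * f (x + d - 1)\<close> that appear are both multiples
    of \<open>f (x + 2 * d) ^ 2\<close>.\<close>
  have shift: "AE x in lborel. f (x + 2 * d) = c * f x"
  proof -
    have "AE x in lborel. f (y + 1 * x + 1) * f (y + 1 * x - 1) = G 1 * f (y + 1 * x + d * 1) ^ 2" for y
      by (rule AE_lborel_affine[OF fe']) simp_all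
    note centre = this
    have "0 \<le> (2 :: real)" by simp
    from centre[of 1] centre[of "- 1"] centre[of d] fe'[OF this] show ?thesis
    proof eventually_elim
      fix x
      assume "f (1 + 1 * x + 1) * f (1 + 1 * x - 1) = G 1 * (f (1 + 1 * x + d * 1))\<^sup>2"
        and "f (- 1 + 1 * x + 1) * f (- 1 + 1 * x - 1) = G 1 * (f (- 1 + 1 * x + d * 1))\<^sup>2"
        and "f (d + 1 * x + 1) * f (d + 1 * x - 1) = G 1 * (f (d + 1 * x + d * 1))\<^sup>2"
        and "f (x + 2) * f (x - 2) = G 2 * (f (x + d * 2))\<^sup>2"
      moreover have "1 + 1 * x + 1 = x + 2" "1 + 1 * x - 1 = x" "- 1 + 1 * x + 1 = x" "- 1 + 1 * x - 1 = x - 2"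
        "1 + 1 * x + d * 1 = d + x + 1" "- 1 + 1 * x + d * 1 = d + x - 1"
        "d + 1 * x + 1 = d + x + 1" "d + 1 * x - 1 = d + x - 1"
        "d + 1 * x + d * 1 = x + 2 * d" "x + d * 2 = x + 2 * d"
        by simp_all
      ultimately have e: "f (x + 2) * f x = G 1 * (f (d + x + 1))\<^sup>2"
        "f x * f (x - 2) = G 1 * (f (d + x - 1))\<^sup>2"
        "f (d + x + 1) * f (d + x - 1) = G 1 * (f (x + 2 * d))\<^sup>2"
        "f (x + 2) * f (x - 2) = G 2 * (f (x + 2 * d))\<^sup>2"
        by (simp_all only:)
      have "(f (x + 2) * f x) * (f x * f (x - 2)) = G 1 ^ 2 * (f (d + x + 1) * f (d + x - 1))\<^sup>2"
        unfolding e(1,2) by (simp add: power2_eq_square)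
      then have "(f x)\<^sup>2 * (f (x + 2) * f (x - 2)) = G 1 ^ 2 * (f (d + x + 1) * f (d + x - 1))\<^sup>2"
        by (simp add: power2_eq_square mult_ac)
      then have "(f x)\<^sup>2 * G 2 * (f (x + 2 * d))\<^sup>2 = G 1 ^ 4 * (f (x + 2 * d))\<^sup>2 * (f (x + 2 * d))\<^sup>2"
        unfolding e(3,4) by (simp add: power_mult_distrib mult_ac power2_eq_square eval_nat_numeral)
      then have "(f x)\<^sup>2 * G 2 = G 1 ^ 4 * (f (x + 2 * d))\<^sup>2"
        using fpos[of "x + 2 * d"] by simp
      then have "(f (x + 2 * d))\<^sup>2 = (c * f x)\<^sup>2"
        using G_pos[of 1] G_pos[of 2] by (simp add: c_def power_mult_distrib power_divide field_simps)
      then show "f (x + 2 * d) = c * f x"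
        using fpos c_pos by (simp add: power2_eq_iff_nonneg less_imp_le)
    qed
  qed
  define S where "S t = measure D {t<..}" for t
  have S: "S (t + 2 * d) = c * S t" for t
    unfolding S_def by (rule measure_Ioi_shift) (use shift c_pos in auto)
  have S_pos: "0 < S t" for t
  proof (rule ccontr)
    assume "\<not> 0 < S t"
    then have "AE x in D. x \<notin> {t<..}"
      using measure_nonneg[of D "{t<..}"]
      by (intro AE_not_in) (simp add: S_def null_sets_def D.emeasure_eq_measure)
    then have "AE x in lborel. 0 < f x \<longrightarrow> \<not> t < x"
      by (simp add: AE_density)
    from not_AE_lborel_Ioo[OF this, of t "t + 1"] fpos show False by simp
  qed
  have S_eq: "S t = 1 - cdf D t" for t
  proof -
    have "{t<..} = UNIV - {..t}" by auto
    then show ?thesis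
      using D.prob_compl[of "{..t}"] by (simp add: S_def cdf_def)
  qed
  have top: "(S \<longlongrightarrow> 0) at_top" and bot: "(S \<longlongrightarrow> 1) at_bot"
    unfolding S_eq[abs_def]
    using tendsto_diff[OF tendsto_const[of "1 :: real"] D.cdf_lim_at_top_prob]
      tendsto_diff[OF tendsto_const[of "1 :: real"] D.cdf_lim_at_bot] by simp_all
  have c1: "c = 1"
  proof -
    have "((\<lambda>t. S (2 * d + t)) \<longlongrightarrow> 1) at_bot"
      by (intro filterlim_compose[OF bot])
         (simp add: filterlim_tendsto_add_at_bot_iff[OF tendsto_const] filterlim_ident)
    moreover have "((\<lambda>t. S (2 * d + t)) \<longlongrightarrow> c * 1) at_bot"
      using tendsto_mult[OF tendsto_const bot, of c] S by (simp add: add.commute)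
    ultimately show ?thesis
      using tendsto_unique[OF trivial_limit_at_bot_linorder] by fastforce
  qed
  have per: "S (t + real n * (2 * d)) = S t" for t n
  proof (induction n)
    case (Suc n)
    then show ?case
      using S[of "t + real n * (2 * d)"] c1 by (simp add: algebra_simps)
  qed simp
  \<comment> \<open>For negative \<open>d\<close> the period is applied from the other end, which
    gives the absolute value.\<close>
  have per': "S (real n * \<bar>2 * d\<bar>) = S 0" for n
    using per[of 0 n] per[of "- real n * (2 * d)" n] by (simp add: abs_if)
  have "filterlim (\<lambda>n. real n * \<bar>2 * d\<bar>) at_top sequentially"
    using Ad by (intro filterlim_at_top_mult_tendsto_pos[OF tendsto_const] filterlim_real_sequentially) auto
  from filterlim_compose[OF top this] have "(\<lambda>n. S 0) \<longlonglongrightarrow> 0"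
    by (simp add: per')
  then have "S 0 = 0"
    by (simp add: LIMSEQ_const_iff)
  with S_pos[of 0] show False by simp
qed

lemma integrable_f: "integrable lborel f"
  using D.emeasure_space_1 nonneg by (intro integrableI_nonneg) (auto simp: emeasure_density)

lemma integral_f: "(LINT x|lborel. f x) = 1"
proof -
  have "ennreal (LINT x|lborel. f x) = (\<integral>\<^sup>+x. f x \<partial>lborel)"
    using integrable_f nonneg by (simp add: nn_integral_eq_integral)
  also have "\<dots> = 1"
    using D.emeasure_space_1 by (simp add: emeasure_density)
  finally show ?thesis
    using nonneg by (simp add: ennreal_eq_1)
qed

lemma char_D_eq: "char D t = (CLINT x|lborel. f x *\<^sub>R iexp (t * x))"
  unfolding char_def using nonneg by (subst integral_density) auto

text \<open>The identity \<open>(A * s + t) * x + (A * s - t) * y = s * A * (x + y) + t * (x -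
  y)\<close> and the separation of the joint density for \<open>B = 0\<close> factor the double
  integral. The witness \<open>\<psi>\<close> is the Fourier integral of
  \<open>k v / (2 * A)\<close>, the density of the difference for the intended
  \<open>k\<close>.\<close>

lemma char_D_mult:
  assumes I: "I = UNIV" and B: "B = 0"
  shows "\<exists>\<psi>. \<forall>s t. char D (A * s + t) * char D (A * s - t) = char D s * \<psi> t"
proof (intro exI allI)
  fix s t :: real
  define p where "p = A * s + t"
  define q where "q = A * s - t"
  define E where "E r x = f x *\<^sub>R iexp (r * x)" for r x
  have E_meas[measurable]: "E r \<in> borel_measurable borel" for r
    unfolding E_def by measurable
  have E_norm: "norm (E r x) = f x" for r x
    using nonneg by (simp add: E_def)
  have E_int: "integrable lborel (E r)" for r
    by (rule Bochner_Integration.integrable_bound[OF integrable_f]) (auto simp: E_norm nonneg)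
  have E_char: "(CLINT x|lborel. E r x) = char D r" for r
    by (simp add: E_def char_D_eq)
  have refl_int: "integrable lborel (\<lambda>v. g (x - v))" if "integrable lborel g"
    for g :: "real \<Rightarrow> 'b :: {banach, second_countable_topology}" and x
    using lborel_integrable_real_affine[OF that, of "-1" x] by simp
  have refl_eq: "(LINT v|lborel. g (x - v)) = (LINT v|lborel. g v)"
    for g :: "real \<Rightarrow> 'b :: {banach, second_countable_topology}" and x
    using lborel_integral_real_affine[of "-1" g x] by simp
  have "char D p * char D q = (CLINT x|lborel. E p x * char D q)"
    by (simp add: E_char)
  \<comment> \<open>The second variable is written as \<open>x - v\<close>, so that after Fubini the
    inner integral runs over \<open>x\<close> at a fixed difference \<open>v\<close>.\<close>
  also have "\<dots> = (CLINT x|lborel. CLINT v|lborel. E p x * E q (x - v))"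
    by (simp add: refl_eq E_char)
  also have "\<dots> = (CLINT v|lborel. CLINT x|lborel. E p x * E q (x - v))"
  proof (rule lborel_pair.Fubini_integral[symmetric])
    show "integrable (lborel \<Otimes>\<^sub>M lborel) (\<lambda>(x, v). E p x * E q (x - v))"
    proof (rule lborel_pair.Fubini_integrable)
      show "(\<lambda>(x, v). E p x * E q (x - v)) \<in> borel_measurable (lborel \<Otimes>\<^sub>M lborel)"
        by measurable
      show "integrable lborel (\<lambda>x. LINT v|lborel. norm (case (x, v) of (x, v) \<Rightarrow> E p x * E q (x - v)))"
        using integrable_f by (simp add: norm_mult E_norm refl_eq integral_f)
      show "AE x in lborel. integrable lborel (\<lambda>v. case (x, v) of (x, v) \<Rightarrow> E p x * E q (x - v))"
        using refl_int[OF E_int] by simp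
    qed
  qed
  also have "\<dots> = (CLINT v|lborel. char D s * (k v / (2 * A) * iexp (t * v)))"
  proof (rule Bochner_Integration.integral_cong[OF refl])
    fix v :: real
    have ae: "AE u in lborel. f ((u + v) / 2) * f ((u - v) / 2) = k v * f (A * u)"
      using eq[of v] by (simp add: I B)
    \<comment> \<open>Here \<open>x = (u + v) / 2\<close>, with Jacobian 1/2.\<close>
    have "(CLINT x|lborel. E p x * E q (x - v)) =
        (1 / 2) *\<^sub>R (CLINT u|lborel. E p (v / 2 + 1 / 2 * u) * E q (v / 2 + 1 / 2 * u - v))"
      by (subst lborel_integral_real_affine[where c = "1/2" and t = "v / 2"]) simp_all
    also have "(CLINT u|lborel. E p (v / 2 + 1 / 2 * u) * E q (v / 2 + 1 / 2 * u - v)) =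
        (CLINT u|lborel. (k v * iexp (t * v)) * E s (0 + A * u) / 1)"
    proof (rule integral_cong_AE)
      show "AE u in lborel. E p (v / 2 + 1 / 2 * u) * E q (v / 2 + 1 / 2 * u - v) =
          (k v * iexp (t * v)) * E s (0 + A * u) / 1"
        using ae
      proof eventually_elim
        fix u assume u: "f ((u + v) / 2) * f ((u - v) / 2) = k v * f (A * u)"
        have arg: "v / 2 + 1 / 2 * u = (u + v) / 2" "(u + v) / 2 - v = (u - v) / 2" "0 + A * u = A * u"
          by (simp_all add: field_simps)
        have "p * ((u + v) / 2) + q * ((u - v) / 2) = t * v + s * (A * u)"
          by (simp add: p_def q_def field_simps)
        then have "iexp (p * ((u + v) / 2)) * iexp (q * ((u - v) / 2)) = iexp (t * v) * iexp (s * (A * u))"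
          unfolding exp_add[symmetric] distrib_left[symmetric] of_real_add[symmetric] by simp
        then have "of_real (f ((u + v) / 2) * f ((u - v) / 2)) *
            (iexp (p * ((u + v) / 2)) * iexp (q * ((u - v) / 2))) =
            of_real (k v * f (A * u)) * (iexp (t * v) * iexp (s * (A * u)))"
          unfolding u by (rule arg_cong)
        then show "E p (v / 2 + 1 / 2 * u) * E q (v / 2 + 1 / 2 * u - v) =
          (k v * iexp (t * v)) * E s (0 + A * u) / 1"
          unfolding arg E_def scaleR_conv_of_real of_real_mult by (simp only: mult_ac div_by_1)
      qed
    qed measurable
    also have "\<dots> = k v * iexp (t * v) * (CLINT u|lborel. E s (0 + A * u))"
      by simp
    also have "(CLINT u|lborel. E s (0 + A * u)) = char D s / A"
      using lborel_integral_real_affine[of A "E s" 0] A_pos E_char[of s]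
      by (simp add: scaleR_conv_of_real)
    finally show "(CLINT x|lborel. E p x * E q (x - v)) = char D s * (k v / (2 * A) * iexp (t * v))"
      by (simp add: scaleR_conv_of_real)
  qed
  \<comment> \<open>Constants leave the integral in every case, a non-integrable function having
    integral 0 by convention.\<close>
  also have "\<dots> = char D s * (CLINT v|lborel. k v / (2 * A) * iexp (t * v))"
    by (rule integral_mult_right_zero)
  finally show "char D (A * s + t) * char D (A * s - t) =
      char D s * (CLINT v|lborel. k v / (2 * A) * iexp (t * v))"
    by (simp add: p_def q_def)
qed

text \<open>Modulus 1 would concentrate the law on the points where
  \<open>cos (x - \<alpha>) = 1\<close>, but \<open>f\<close> is positive on
  \<open>(\<alpha>, \<alpha> + 1)\<close>, where this cosine is below 1.\<close>

lemma norm_char_D_1: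
  assumes I: "I = UNIV"
  shows "norm (char D 1) < 1"
proof (rule ccontr)
  assume "\<not> norm (char D 1) < 1"
  then have "norm (char D 1) = 1"
    using D.cmod_char_le_1[of 1] by simp
  then obtain \<alpha> where \<alpha>: "char D 1 = exp (\<i> * of_real \<alpha>)"
    by (metis complex_norm_eq_1_exp)
  have "(CLINT x|D. iexp (x - \<alpha>)) = (CLINT x|D. exp (- \<i> * of_real \<alpha>) * iexp (1 * x))"
    by (simp add: algebra_simps exp_diff exp_minus field_simps)
  also have "\<dots> = exp (- \<i> * of_real \<alpha>) * char D 1"
    unfolding char_def by (rule integral_mult_right_zero)
  also have "\<dots> = 1"
    by (simp add: \<alpha> exp_minus)
  finally have "(CLINT x|D. iexp (x - \<alpha>)) = 1" .
  moreover have int: "complex_integrable D (\<lambda>x. iexp (x - \<alpha>))"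
    by (intro D.integrable_const_bound[where B = 1]) auto
  ultimately have "(LINT x|D. Re (iexp (x - \<alpha>))) = 1"
    by simp
  moreover have int': "integrable D (\<lambda>x. cos (x - \<alpha>))"
    by (intro D.integrable_const_bound[where B = 1]) auto
  ultimately have "(LINT x|D. 1 - cos (x - \<alpha>)) = 0"
    using D.prob_space by (simp add: Re_exp)
  moreover have "integrable D (\<lambda>x. 1 - cos (x - \<alpha>))"
    using int' by simp
  ultimately have "AE x in D. 1 - cos (x - \<alpha>) = 0"
    by (subst (asm) integral_nonneg_eq_0_iff_AE) auto
  then have ae: "AE x in lborel. 0 < f x \<longrightarrow> cos (x - \<alpha>) = 1"
    by (simp add: AE_density)
  have "\<not> (0 < f x \<longrightarrow> cos (x - \<alpha>) = 1)" if "\<alpha> < x" "x < \<alpha> + 1" for x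
    using cos_monotone_0_pi[of 0 "x - \<alpha>"] that pos[of x] pi_gt3 by (simp add: I)
  with not_AE_lborel_Ioo[OF ae, of \<alpha> "\<alpha> + 1"] show False by simp
qed

text \<open>In the product formula \<open>s = 0\<close> identifies \<open>\<psi>\<close> and
  \<open>t = 0\<close> gives the scaling relation; replacing \<open>s\<close> by
  \<open>s / A\<close> then removes \<open>A\<close> from the equation.\<close>

lemma whole_line_char:
  assumes I: "I = UNIV"
  shows "\<exists>\<sigma>>0. \<forall>s. char D s = complex_of_real (exp (- (\<sigma> * s)\<^sup>2 / 2))"
proof -
  obtain \<psi> where \<psi>: "char D (A * s + t) * char D (A * s - t) = char D s * \<psi> t" for s t
    using char_D_mult[OF I whole_line_B_eq_0[OF I]] by blast
  have \<psi>_eq: "\<psi> t = char D t * char D (- t)" for t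
    using \<psi>[of 0 t] by (simp add: D.char_zero)
  have scale: "char D (A * s) ^ 2 = char D s" for s
    using \<psi>[of s 0] by (simp add: \<psi>_eq D.char_zero power2_eq_square)
  show ?thesis
  proof (rule centered_normal_char[OF _ D.char_zero _ norm_char_D_1[OF I] A_pos scale])
    show "continuous_on UNIV (char D)"
      using D.isCont_char by (simp add: continuous_at_imp_continuous_on)
    show "char D (- t) = cnj (char D t)" for t
      unfolding char_def Bochner_Integration.integral_cnj[symmetric]
      by (simp add: exp_cnj del: Bochner_Integration.integral_cnj)
    show "char D (s + t) * char D (s - t) = char D s ^ 2 * (char D t * char D (- t))" for s t
      using \<psi>[of "s / A" t] scale[of "s / A"] A_pos by (simp add: \<psi>_eq)
  qed
qed

end

section \<open>From the functional equation to the distribution\<close>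

text \<open>Levy's uniqueness theorem applies to \<open>X / \<sigma>\<close>, whose characteristic
  function is the standard normal one; scaling back gives \<open>X\<close>.\<close>

lemma (in prob_space) distributed_normal_if_char:
  assumes X[measurable]: "X \<in> borel_measurable M" and "0 < \<sigma>"
    and char: "\<And>s. char (distr M borel X) s = complex_of_real (exp (- (\<sigma> * s)\<^sup>2 / 2))"
  shows "distributed M lborel X (normal_density 0 \<sigma>)"
proof -
  have "char (distr M borel (\<lambda>\<omega>. X \<omega> / \<sigma>)) s = char (distr M borel X) (s / \<sigma>)" for s
    unfolding char_def by (subst (1 2) integral_distr) auto
  then have "char (distr M borel (\<lambda>\<omega>. X \<omega> / \<sigma>)) = char std_normal_distribution"
    using \<open>0 < \<sigma>\<close> by (simp add: fun_eq_iff char char_std_normal_distribution)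
  then have "distr M borel (\<lambda>\<omega>. X \<omega> / \<sigma>) = std_normal_distribution"
    by (intro Levy_uniqueness real_distribution_distr real_dist_normal_dist) simp_all
  moreover have "distr M lborel (\<lambda>\<omega>. X \<omega> / \<sigma>) = distr M borel (\<lambda>\<omega>. X \<omega> / \<sigma>)"
    by (rule distr_cong) simp_all
  ultimately have "distr M lborel (\<lambda>\<omega>. X \<omega> / \<sigma>) = density lborel std_normal_density"
    by simp
  then have "distributed M lborel (\<lambda>\<omega>. X \<omega> / \<sigma>) std_normal_density"
    by (simp add: distributed_def)
  from normal_density_affine[OF this, of \<sigma> 0] \<open>0 < \<sigma>\<close> show ?thesis by simp
qed

text \<open>The endpoint \<open>a\<close> is 0 by \<open>half_line\<close>, and the tails give the
  distribution function that characterises the exponential law.\<close>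

lemma (in prob_space) distributed_exponential_if_half_line:
  assumes X: "distributed M lborel X f" and eq: "sum_diff_equation f {a<..} A B k"
  shows "\<exists>l>0. distributed M lborel X (exponential_density l)"
proof -
  interpret sum_diff_equation f "{a<..}" A B k by (rule eq)
  obtain l where l: "0 < l" and tail: "\<And>t. 0 \<le> t \<Longrightarrow> measure D {t<..} = exp (- t * l)"
    using half_line[OF refl] by blast
  have Xm[measurable]: "X \<in> borel_measurable M"
    using distributed_measurable[OF X] by simp
  have "\<P>(\<omega> in M. X \<omega> \<le> t) = 1 - exp (- t * l)" if "0 \<le> t" for t
  proof -
    have "\<P>(\<omega> in M. X \<omega> \<le> t) = measure (distr M lborel X) {..t}"
      by (subst measure_distr) (auto intro!: arg_cong[where f = prob])
    also have "distr M lborel X = D"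
      by (rule distributed_distr_eq_density[OF X])
    also have "measure D {..t} = 1 - measure D {t<..}"
    proof -
      have "UNIV - {..t} = {t<..}" by auto
      then show ?thesis
        using D.prob_compl[of "{..t}"] by simp
    qed
    finally show ?thesis
      by (simp add: tail[OF that])
  qed
  then show ?thesis
    using l exponential_distributed_iff[OF l] Xm by blast
qed

text \<open>Taking the equation at \<open>- u\<close> swaps the two factors on the left and changes
  the sign of \<open>B\<close>. Left half-lines thus reduce to right ones.\<close>

lemma sum_diff_equation_uminus:
  assumes eq: "sum_diff_equation f {..<b} A B k"
  shows "sum_diff_equation (\<lambda>x. f (- x)) {- b<..} A (- B) k"
proof -
  interpret sum_diff_equation f "{..<b}" A B k by (rule eq)
  have inf: "ennreal \<bar>v\<bar> < emeasure lborel {..<b}" for v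
    by (simp add: ennreal_less_emeasure_half_line)
  show ?thesis
  proof (rule sum_diff_equation.intro)
    show "(\<lambda>x. f (- x)) \<in> borel_measurable borel" by measurable
    show "0 < f (- x)" if "x \<in> {- b<..}" for x
      using that by (intro pos) auto
    show "f (- x) = 0" if "x \<notin> {- b<..}" for x
      using that by (intro zero) auto
    have "(\<integral>\<^sup>+x. ennreal (f (- x)) \<partial>lborel) = (\<integral>\<^sup>+x. ennreal (f x) \<partial>lborel)"
      using nn_integral_real_affine[of "\<lambda>x. ennreal (f x)" "-1" 0] by simp
    then show "prob_space (density lborel (\<lambda>x. ennreal (f (- x))))"
      using D.emeasure_space_1 by (intro prob_spaceI) (simp add: emeasure_density)
    show "0 < k v" for v
      by (rule k_pos[OF inf])
    fix v
    have "AE u in lborel. f ((0 + - 1 * u + v) / 2) * f ((0 + - 1 * u - v) / 2) =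
        k v * f (A * (0 + - 1 * u) + B * \<bar>v\<bar>)"
      by (rule AE_lborel_affine[OF local.eq[OF inf]]) simp
    then show "AE u in lborel. f (- ((u + v) / 2)) * f (- ((u - v) / 2)) = k v * f (- (A * u + - B * \<bar>v\<bar>))"
    proof eventually_elim
      fix u
      assume u: "f ((0 + - 1 * u + v) / 2) * f ((0 + - 1 * u - v) / 2) = k v * f (A * (0 + - 1 * u) + B * \<bar>v\<bar>)"
      have "(0 + - 1 * u + v) / 2 = - ((u - v) / 2)" "(0 + - 1 * u - v) / 2 = - ((u + v) / 2)"
        "A * (0 + - 1 * u) + B * \<bar>v\<bar> = - (A * u + - B * \<bar>v\<bar>)"
        by (simp_all add: field_simps)
      with u show "f (- ((u + v) / 2)) * f (- ((u - v) / 2)) = k v * f (- (A * u + - B * \<bar>v\<bar>))"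
        by (simp only: mult.commute)
    qed
  qed (rule A_pos)
qed

lemma (in prob_space) sum_diff_equation_if_cond_density:
  fixes f :: "real \<Rightarrow> real" and X :: "'a \<Rightarrow> real"
  assumes f[measurable]: "f \<in> borel_measurable borel"
    and X: "distributed M lborel X f"
    and pos: "\<And>x. x \<in> I \<Longrightarrow> 0 < f x" and zero: "\<And>x. x \<notin> I \<Longrightarrow> f x = 0"
    and "0 < A"
    and cond: "\<And>v. ennreal \<bar>v\<bar> < emeasure lborel I \<Longrightarrow>
      AE u in lborel. sum_cond_density f v u = A * f (A * u + B * \<bar>v\<bar>)"
  shows "sum_diff_equation f I A B (\<lambda>v. 2 * A * diff_density f v)"
proof (rule sum_diff_equation.intro)
  have nonneg: "0 \<le> f x" for x
    using pos[of x] zero[of x] by (cases "x \<in> I") auto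
  have Xm[measurable]: "X \<in> borel_measurable M"
    using distributed_measurable[OF X] by simp
  show P: "prob_space (density lborel (\<lambda>x. ennreal (f x)))"
    using prob_space_distr[of X lborel] distributed_distr_eq_density[OF X] by simp
  fix v assume v: "ennreal \<bar>v\<bar> < emeasure lborel I"
  \<comment> \<open>Division by 0 yields 0, so a zero here, whether genuine or the default of a
    divergent integral, would make \<open>f\<close> vanish almost everywhere.\<close>
  have "diff_density f v \<noteq> 0"
  proof
    assume "diff_density f v = 0"
    have "AE u in lborel. f (A * u + B * \<bar>v\<bar>) = 0"
      using cond[OF v]
    proof eventually_elim
      fix u assume "sum_cond_density f v u = A * f (A * u + B * \<bar>v\<bar>)"
      moreover have "sum_cond_density f v u = 0"
        unfolding sum_cond_density_def \<open>diff_density f v = 0\<close> by simp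
      ultimately show "f (A * u + B * \<bar>v\<bar>) = 0"
        using \<open>0 < A\<close> by simp
    qed
    then have "AE x in lborel. f (A * (- (B * \<bar>v\<bar>) / A + 1 / A * x) + B * \<bar>v\<bar>) = 0"
      by (rule AE_lborel_affine) (use \<open>0 < A\<close> in simp)
    moreover have "A * (- (B * \<bar>v\<bar>) / A + 1 / A * x) + B * \<bar>v\<bar> = x" for x
      using \<open>0 < A\<close> by (simp add: field_simps)
    ultimately have "AE x in lborel. f x = 0"
      by simp
    then have "(\<integral>\<^sup>+x. ennreal (f x) \<partial>lborel) = 0"
      by (subst nn_integral_0_iff_AE) auto
    then show False
      using prob_space.emeasure_space_1[OF P] by (simp add: emeasure_density)
  qed
  moreover have "0 \<le> diff_density f v"
    unfolding diff_density_def sum_diff_density_def using nonneg by (intro Bochner_Integration.integral_nonneg) simp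
  ultimately have g: "0 < diff_density f v"
    by simp
  then show "0 < 2 * A * diff_density f v"
    using \<open>0 < A\<close> by simp
  show "AE u in lborel. f ((u + v) / 2) * f ((u - v) / 2) = 2 * A * diff_density f v * f (A * u + B * \<bar>v\<bar>)"
    using cond[OF v]
  proof eventually_elim
    fix u assume "sum_cond_density f v u = A * f (A * u + B * \<bar>v\<bar>)"
    then show "f ((u + v) / 2) * f ((u - v) / 2) = 2 * A * diff_density f v * f (A * u + B * \<bar>v\<bar>)"
      using g by (simp add: sum_cond_density_def sum_diff_density_def field_simps)
  qed
qed (use assms in auto)

text \<open>The laws on the right carry no location parameter: moving \<open>X\<close> by
  \<open>m\<close> moves \<open>X + Y\<close> by \<open>2 * m\<close> but the density
  \<open>A * f (A * u + B * |v|)\<close> by \<open>m / A\<close>, and with \<open>A\<close> equal to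
  1 or \<open>1 / sqrt 2\<close> these agree only for \<open>m = 0\<close>.\<close>

theorem theorem1:
  fixes M :: "'a measure" and X Y :: "'a \<Rightarrow> real"
    and f :: "real \<Rightarrow> real" and I :: "real set"
  assumes "prob_space M"
    and "prob_space.indep_var M borel X borel Y"
    and "distributed M lborel X f"
    and "distributed M lborel Y f"
    and "open I" and "is_interval I"
    and "\<And>x. x \<in> I \<Longrightarrow> 0 < f x"
    and "\<And>x. x \<notin> I \<Longrightarrow> f x = 0"
  shows "(\<exists>A B :: real. 0 < A \<and>
            (\<forall>v. ennreal \<bar>v\<bar> < emeasure lborel I \<longrightarrow>
              (AE u in lborel. sum_cond_density f v u = A * f (A * u + B * \<bar>v\<bar>))))
         \<longleftrightarrow>
         (\<exists>l>0. distributed M lborel X (exponential_density l)) \<or>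
         (\<exists>l>0. distributed M lborel (\<lambda>\<omega>. - X \<omega>) (exponential_density l)) \<or>
         (\<exists>\<sigma>>0. distributed M lborel X (normal_density 0 \<sigma>))"
    (is "?C \<longleftrightarrow> ?D")
proof
  interpret prob_space M by fact
  note X = assms(3) and pos = assms(7) and zero = assms(8)
  have nonneg: "0 \<le> f x" for x
    using pos[of x] zero[of x] by (cases "x \<in> I") auto
  have f[measurable]: "f \<in> borel_measurable borel"
    using distributed_real_measurable[OF _ X] nonneg by simp
  show ?C if ?D
    using cond_density_if[OF f nonneg X that] by blast
  show ?D if ?C
  proof -
    from that obtain A B where "0 < A" and "\<And>v. ennreal \<bar>v\<bar> < emeasure lborel I \<Longrightarrow>
        AE u in lborel. sum_cond_density f v u = A * f (A * u + B * \<bar>v\<bar>)"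
      by blast
    then have FE: "sum_diff_equation f I A B (\<lambda>v. 2 * A * diff_density f v)"
      by (intro sum_diff_equation_if_cond_density[OF f X pos zero])
    interpret sum_diff_equation f I A B "\<lambda>v. 2 * A * diff_density f v"
      by (rule FE)
    have "I \<noteq> {}"
    proof
      assume "I = {}"
      then have "f = (\<lambda>_. 0)"
        using zero by auto
      then show False
        using integral_f by simp
    qed
    with \<open>open I\<close> \<open>is_interval I\<close> show ?D
    proof (cases rule: open_interval_cases)
      case 1
      obtain \<sigma> where "0 < \<sigma>" "\<And>s. char D s = complex_of_real (exp (- (\<sigma> * s)\<^sup>2 / 2))"
        using whole_line_char[OF 1] by blast
      moreover have "distr M borel X = D"
        unfolding distributed_distr_eq_density[OF X, symmetric] by (rule distr_cong) simp_all
      ultimately show ?thesis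
        using distributed_normal_if_char[of X \<sigma>] distributed_measurable[OF X] by auto
    next
      case (2 a)
      then show ?thesis
        using distributed_exponential_if_half_line[OF X] FE by blast
    next
      case (3 b)
      then show ?thesis
        using distributed_exponential_if_half_line[OF distributed_uminus_lborel[OF f X]]
          sum_diff_equation_uminus FE by blast
    next
      case (4 a b)
      then show ?thesis
        using not_bounded by blast
    qed
  qed
qed

end
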